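(* Let $R>1$ be fixed. There exist constants $C>0$ and $c>0$ such that for any $n,d\in\mathbb N$ with $d\ge2$, $$\frac{d}{n\log d}\ge C\quad\text{and}\quad n\ge\sqrt d\,\log d,$$ it holds that $$\mathfrak d(\mathcal Q,\mathcal P)\ge c,$$ where $\mathcal Q=\{Q_q:q\in\mathcal F\}$ is the multinomial experiment (with $n$ i.i.d. draws) and $\mathcal P=\{P_q:q\in\mathcal F\}$ is the Gaussian experiment defined in the context.
   Context: $\mathbb S^d=\{q\in[0,1]^d:\sum_{i=1}^dq_i=1\}$ and $\mathcal F=\{q\in\mathbb S^d:\max_iq_i/\min_iq_i\le R\}$. $Q_q$ is the law on $\{1,\dots,d\}^n$ of $n$ i.i.d. draws from the distribution $q$ on $\{1,\dots,d\}$. $P_q$ is the law on $\mathbb R^d$ of $X=(X_1,\dots,X_d)$ with $X_i=\sqrt{q_i}+\frac1{\sqrt{2n}}Z_i$, $Z=(Z_1,\dots,Z_d)\sim N(0,I_d)$. For two experiments $\mathcal A=\{A_f:f\in\mathcal F\}$ on $(\mathcal X,\mathscr X)$ and $\mathcal B=\{B_f:f\in\mathcal F\}$ on $(\tilde{\mathcal X},\tilde{\mathscr X})$ with the same index set (dominated, on Polish spaces with Borel sigma-algebras), the deficiency of $\mathcal A$ with respect to $\mathcal B$ is $$\mathfrak d(\mathcal A,\mathcal B)=\mathfrak d(\mathcal A;\mathcal B)=\inf_{K}\sup_{f\in\mathcal F}\|A_fK-B_f\|_{\mathrm{TV}},$$ the infimum being over all Markov kernels $K:\tilde{\mathscr X}\times\mathcal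 X\to[0,1]$, where $A_fK(\cdot)=\int K(\cdot\mid x)\,dA_f(x)$ and $\|P-Q\|_{\mathrm{TV}}=\sup_A|P(A)-Q(A)|$. *)

theory Defs
  imports "HOL-Probability.Probability"
begin

definition tv_dist :: "'a measure \<Rightarrow> 'a measure \<Rightarrow> real" where
  "tv_dist M N = (SUP A\<in>sets M. \<bar>measure M A - measure N A\<bar>)"

(* A Markov kernel from X to Y is a measurable map from X into the Giry space of probability
   measures on Y, and bind (A f) K is the mixture of K under A f.  For a nonempty index set, a
   nonempty target space and probability measures A f, B f, the sets under SUP and INF are nonempty
   subsets of the unit interval (see the lemmas below), so the real-valued SUP and INF are genuine. *)
definition deficiency ::
  "'i set \<Rightarrow> 'x measure \<Rightarrow> ('i \<Rightarrow> 'x measure) \<Rightarrow> 'y measure \<Rightarrow> ('i \<Rightarrow> 'y measure) \<Rightarrow> real" where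
  "deficiency F X A Y B =
     (INF K \<in> X \<rightarrow>\<^sub>M prob_algebra Y. SUP f\<in>F. tv_dist (bind (A f) K) (B f))"

definition prob_simplex :: "nat \<Rightarrow> (nat \<Rightarrow> real) set" where
  "prob_simplex d = {q \<in> {1..d} \<rightarrow>\<^sub>E {0..1}. (\<Sum>i=1..d. q i) = 1}"

(* Positivity is stated separately because x / 0 = 0 in HOL, whereas the ratio counts as infinite
   when the minimum vanishes. *)
definition bounded_ratio_simplex :: "real \<Rightarrow> nat \<Rightarrow> (nat \<Rightarrow> real) set" where
  "bounded_ratio_simplex R d =
     {q \<in> prob_simplex d. 0 < Min (q ` {1..d}) \<and> Max (q ` {1..d}) / Min (q ` {1..d}) \<le> R}"

definition draws_space :: "nat \<Rightarrow> nat \<Rightarrow> (nat \<Rightarrow> nat) measure" where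
  "draws_space n d = PiM {1..n} (\<lambda>_. count_space {1..d})"

definition multinomial_law :: "nat \<Rightarrow> nat \<Rightarrow> (nat \<Rightarrow> real) \<Rightarrow> (nat \<Rightarrow> nat) measure" where
  "multinomial_law n d q = PiM {1..n} (\<lambda>_. point_measure {1..d} (\<lambda>i. ennreal (q i)))"

(* The finite product sigma-algebra is the Borel sigma-algebra of R^d. *)
definition euclidean_borel :: "nat \<Rightarrow> (nat \<Rightarrow> real) measure" where
  "euclidean_borel d = PiM {1..d} (\<lambda>_. borel)"

definition std_gaussian :: "nat \<Rightarrow> (nat \<Rightarrow> real) measure" where
  "std_gaussian d = PiM {1..d} (\<lambda>_. density lborel (\<lambda>x. ennreal (std_normal_density x)))"

definition gaussian_law :: "nat \<Rightarrow> nat \<Rightarrow> (nat \<Rightarrow> real) \<Rightarrow> (nat \<Rightarrow> real) measure" where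
  "gaussian_law n d q =
     distr (std_gaussian d) (euclidean_borel d)
       (\<lambda>z. \<lambda>i\<in>{1..d}. sqrt (q i) + 1 / sqrt (2 * real n) * z i)"

lemma prob_simplex_point_measure:
  assumes "q \<in> prob_simplex d"
  shows "prob_space (point_measure {1..d} (\<lambda>i. ennreal (q i)))"
proof (rule prob_spaceI)
  have nn: "\<And>i. i \<in> {1..d} \<Longrightarrow> 0 \<le> q i"
    using assms by (auto simp: prob_simplex_def PiE_def Pi_def)
  have "emeasure (point_measure {1..d} (\<lambda>i. ennreal (q i))) {1..d} = (\<Sum>i=1..d. ennreal (q i))"
    by (subst emeasure_point_measure_finite) auto
  also have "\<dots> = ennreal (\<Sum>i=1..d. q i)"
    using nn by (intro sum_ennreal) auto
  finally show "emeasure (point_measure {1..d} (\<lambda>i. ennreal (q i)))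
      (space (point_measure {1..d} (\<lambda>i. ennreal (q i)))) = 1"
    using assms by (simp add: prob_simplex_def space_point_measure)
qed

lemma multinomial_law_in_prob_algebra:
  assumes "q \<in> prob_simplex d"
  shows "multinomial_law n d q \<in> space (prob_algebra (draws_space n d))"
proof -
  have "prob_space (multinomial_law n d q)"
    unfolding multinomial_law_def
    by (intro prob_space_PiM prob_simplex_point_measure[OF assms])
  moreover have "sets (multinomial_law n d q) = sets (draws_space n d)"
    unfolding multinomial_law_def draws_space_def
    by (intro sets_PiM_cong) (auto simp: sets_point_measure)
  ultimately show ?thesis by (simp add: space_prob_algebra)
qed

lemma gaussian_law_in_prob_algebra:
  "gaussian_law n d q \<in> space (prob_algebra (euclidean_borel d))"
proof -
  have "prob_space (std_gaussian d)"
    unfolding std_gaussian_def by (intro prob_space_PiM prob_space_normal_density) simp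
  moreover have "(\<lambda>z. \<lambda>i\<in>{1..d}. sqrt (q i) + 1 / sqrt (2 * real n) * z i)
      \<in> std_gaussian d \<rightarrow>\<^sub>M euclidean_borel d"
    unfolding std_gaussian_def euclidean_borel_def
    by (intro measurable_restrict borel_measurable_add borel_measurable_times
        borel_measurable_const) (auto intro!: measurable_component_singleton
          measurable_compose[OF measurable_component_singleton])
  ultimately show ?thesis
    by (simp add: space_prob_algebra gaussian_law_def prob_space.prob_space_distr)
qed

lemma uniform_in_bounded_ratio_simplex:
  assumes "1 \<le> R" "0 < d"
  shows "(\<lambda>i\<in>{1..d}. 1 / real d) \<in> bounded_ratio_simplex R d"
proof -
  have "{1..d} \<noteq> {}"
    using assms by simp
  then have "(\<lambda>i\<in>{1..d}. 1 / real d) ` {1..d} = {1 / real d}"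
    by auto
  then show ?thesis
    using assms by (auto simp: bounded_ratio_simplex_def prob_simplex_def)
qed

lemma tv_dist_bounds:
  assumes "prob_space M" "prob_space N"
  shows "0 \<le> tv_dist M N" "tv_dist M N \<le> 1"
proof -
  have *: "\<bar>measure M A - measure N A\<bar> \<le> 1" for A
    using prob_space.prob_le_1[OF assms(1), of A] prob_space.prob_le_1[OF assms(2), of A]
      measure_nonneg[of M A] measure_nonneg[of N A] by linarith
  show "tv_dist M N \<le> 1"
    unfolding tv_dist_def using * by (intro cSUP_least) auto
  have "\<bar>measure M {} - measure N {}\<bar> \<le> tv_dist M N"
    unfolding tv_dist_def using * by (intro cSUP_upper bdd_aboveI2) auto
  then show "0 \<le> tv_dist M N" by simp
qed

lemma deficiency_term_bounds:
  assumes "A f \<in> space (prob_algebra X)" "B f \<in> space (prob_algebra Y)"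
    and "K \<in> X \<rightarrow>\<^sub>M prob_algebra Y"
  shows "0 \<le> tv_dist (bind (A f) K) (B f)" "tv_dist (bind (A f) K) (B f) \<le> 1"
proof -
  have "prob_space (bind (A f) K)"
    using prob_space_bind'[OF assms(1,3)] .
  moreover have "prob_space (B f)"
    using assms(2) by (simp add: space_prob_algebra)
  ultimately show "0 \<le> tv_dist (bind (A f) K) (B f)" "tv_dist (bind (A f) K) (B f) \<le> 1"
    by (rule tv_dist_bounds)+
qed

lemma markov_kernels_nonempty:
  assumes "M \<in> space (prob_algebra Y)"
  shows "X \<rightarrow>\<^sub>M prob_algebra Y \<noteq> {}"
  using measurable_const[OF assms, of X] by blast

end

theory Submission
  imports Defs
begin

text \<open>
  The Gaussian experiment contains a statistic that the multinomial experiment cannot match when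
  \<open>d\<close> is much larger than \<open>n\<close>. Compare the uniform distribution with the perturbations
  \<open>q i = (1 \<plusminus> e) / d\<close>, where the coordinates come in pairs with opposite signs and the signs of
  the pairs are random.

  In the Gaussian experiment the means are square roots, so by concavity every perturbation lowers
  the sum of the means by an amount of order \<open>e\<^sup>2 * sqrt d\<close>, whatever the signs. The noise of
  \<open>\<Sum>i. X i\<close> has standard deviation \<open>sqrt (d / (2 * n))\<close>, hence thresholding this sum separates
  the two hypotheses as soon as \<open>e\<^sup>2\<close> is a large multiple of \<open>1 / sqrt n\<close>
  (\<open>sum_sqrt_perturbed_uniform_le\<close>, \<open>gaussian_law_sum_test\<close>).

  With \<open>n\<close> multinomial draws the signs are unknown, and the information about \<open>e\<close> sits in
  coincidences between draws. The chi-square divergence of the sign mixture from the uniform law is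
  at most \<open>exp (2 * e ^ 4 * n\<^sup>2 / d) - 1\<close> (\<open>second_moment_perturbed_mixture\<close>). For
  \<open>e\<^sup>2\<close> of order \<open>1 / sqrt n\<close> the exponent is of order \<open>n / d\<close>, which is small.

  A Markov kernel cannot create information: if it turned every multinomial law into something close
  to the Gaussian law, the Gaussian threshold test would pull back to a multinomial test that
  separates hypotheses which are almost indistinguishable (\<open>deficiency_ge_of_test\<close>). The growth
  condition on \<open>n\<close> makes \<open>n\<close>, and with it \<open>1 / e\<close>, large enough for
  the perturbations to respect the ratio bound \<open>R\<close>.
\<close>

section \<open>Deficiency and testing\<close>

text \<open>
  Le Cam's two-hypotheses argument for the null parameter \<open>h\<close> against the uniform mixture over
  the finite family \<open>g ` S\<close>. A kernel that brings the first experiment within \<open>D\<close> of the second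
  pulls the event \<open>E\<close> back to a randomised test of the first experiment, at the cost of \<open>D\<close>
  under each hypothesis. Since no such test gains more than \<open>r\<close>, the gain \<open>b - a\<close> of \<open>E\<close> is
  at most \<open>r + 2 * D\<close>.
\<close>
lemma deficiency_ge_of_test:
  assumes A: "\<And>f. f \<in> F \<Longrightarrow> A f \<in> space (prob_algebra X)"
    and B: "\<And>f. f \<in> F \<Longrightarrow> B f \<in> space (prob_algebra Y)"
    and h: "h \<in> F" and S: "finite S" "S \<noteq> {}" and g: "\<And>s. s \<in> S \<Longrightarrow> g s \<in> F"
    and E: "E \<in> sets Y"
    and null: "measure (B h) E \<ge> b" and alt: "\<And>s. s \<in> S \<Longrightarrow> measure (B (g s)) E \<le> a"
    and tests: "\<And>\<phi>. \<phi> \<in> borel_measurable X \<Longrightarrow> (\<And>x. 0 \<le> \<phi> x \<and> \<phi> x \<le> 1) \<Longrightarrow>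
       integral\<^sup>L (A h) \<phi> - (\<Sum>s\<in>S. integral\<^sup>L (A (g s)) \<phi>) / card S \<le> r"
  shows "deficiency F X A Y B \<ge> (b - a - r) / 2"
  unfolding deficiency_def
proof (rule cINF_greatest)
  show "X \<rightarrow>\<^sub>M prob_algebra Y \<noteq> {}"
    using markov_kernels_nonempty[OF B[OF h]] .
next
  fix K assume K: "K \<in> X \<rightarrow>\<^sub>M prob_algebra Y"
  define D where "D = (SUP f\<in>F. tv_dist (bind (A f) K) (B f))"
  define \<phi> where "\<phi> = (\<lambda>x. if x \<in> space X then measure (K x) E else 0)"
  have Ksub: "K \<in> X \<rightarrow>\<^sub>M subprob_algebra Y"
    using K by (rule measurable_prob_algebraD)
  have \<phi>_meas: "\<phi> \<in> borel_measurable X"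
  proof -
    have "(\<lambda>x. measure (K x) E) \<in> borel_measurable X"
      using Ksub E by (intro measure_measurable_subprob_algebra2[where M=X] pair_measureI) auto
    then show ?thesis
      unfolding \<phi>_def by (subst measurable_cong[where g="\<lambda>x. measure (K x) E"]) auto
  qed
  have \<phi>01: "0 \<le> \<phi> x \<and> \<phi> x \<le> 1" for x
  proof (cases "x \<in> space X")
    case True
    then have "prob_space (K x)"
      using measurable_space[OF K] by (auto simp: space_prob_algebra)
    then show ?thesis
      using True prob_space.prob_le_1 by (auto simp: \<phi>_def)
  qed (simp add: \<phi>_def)
  \<comment> \<open>A kernel turns the event into the randomised test, so closeness in total
    variation transfers its probability to the mean of that test.\<close>
  have near: "\<bar>integral\<^sup>L (A f) \<phi> - measure (B f) E\<bar> \<le> D" if f: "f \<in> F" for f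
  proof -
    have Af: "prob_space (A f)" "sets (A f) = sets X"
      using A[OF f] by (auto simp: space_prob_algebra)
    have sp: "space (A f) = space X"
      using Af(2) by (rule sets_eq_imp_space_eq)
    interpret Af: prob_space "A f" by fact
    have Kf: "K \<in> A f \<rightarrow>\<^sub>M subprob_algebra Y"
      using Ksub Af(2) by (simp cong: measurable_cong_sets)
    have AK: "prob_space (bind (A f) K)"
      using prob_space_bind'[OF A[OF f] K] .
    have BK: "prob_space (B f)"
      using B[OF f] by (simp add: space_prob_algebra)
    have "measure (bind (A f) K) E = (\<integral>x. measure (K x) E \<partial>A f)"
      using Af.measure_bind[OF Kf E] .
    also have "\<dots> = integral\<^sup>L (A f) \<phi>"
      by (rule Bochner_Integration.integral_cong) (auto simp: \<phi>_def sp)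
    finally have eq: "measure (bind (A f) K) E = integral\<^sup>L (A f) \<phi>" .
    have le1: "\<bar>measure (bind (A f) K) A' - measure (B f) A'\<bar> \<le> 1" for A'
      using prob_space.prob_le_1[OF AK, of A'] prob_space.prob_le_1[OF BK, of A']
        measure_nonneg[of "bind (A f) K" A'] measure_nonneg[of "B f" A'] by linarith
    have "sets (bind (A f) K) = sets Y"
      by (rule sets_bind[OF sets_kernel[OF Kf]]) (auto simp: Af.not_empty)
    then have "\<bar>measure (bind (A f) K) E - measure (B f) E\<bar> \<le> tv_dist (bind (A f) K) (B f)"
      unfolding tv_dist_def using le1 E by (intro cSUP_upper bdd_aboveI2) auto
    also have "\<dots> \<le> D"
      unfolding D_def using f deficiency_term_bounds(2)[where A=A and B=B, OF A B K]
      by (intro cSUP_upper bdd_aboveI2) auto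
    finally show ?thesis by (simp add: eq)
  qed
  have cS: "real (card S) > 0"
    using S by (simp add: card_gt_0_iff)
  have "(\<Sum>s\<in>S. integral\<^sup>L (A (g s)) \<phi>) \<le> (\<Sum>s\<in>S. a + D)"
  proof (rule sum_mono)
    fix s assume "s \<in> S"
    then show "integral\<^sup>L (A (g s)) \<phi> \<le> a + D"
      using near[OF g] alt by force
  qed
  then have "(\<Sum>s\<in>S. integral\<^sup>L (A (g s)) \<phi>) / card S \<le> a + D"
    using cS by (simp add: field_simps)
  moreover have "b - D \<le> integral\<^sup>L (A h) \<phi>"
    using near[OF h] null by linarith
  moreover have "x - y \<le> r \<Longrightarrow> y \<le> a + D \<Longrightarrow> b - D \<le> x \<Longrightarrow> b - a - r \<le> D + D" for x y
    by linarith
  ultimately have "b - a - r \<le> D + D"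
    using tests[OF \<phi>_meas \<phi>01] by blast
  then show "(b - a - r) / 2 \<le> (SUP f\<in>F. tv_dist (bind (A f) K) (B f))"
    unfolding D_def by simp
qed

text \<open>
  The right side is the square root of the chi-square divergence of \<open>g\<close> from \<open>p\<close>; it bounds
  the \<open>L\<^sup>1\<close> distance by the Cauchy-Schwarz inequality with weight \<open>p\<close>.
\<close>
lemma chi_square_test_bound:
  fixes p g \<phi> :: "'a \<Rightarrow> real"
  assumes "finite X" and p: "\<And>x. x \<in> X \<Longrightarrow> 0 < p x" "(\<Sum>x\<in>X. p x) = 1"
    and g: "(\<Sum>x\<in>X. g x) = 1" and \<phi>: "\<And>x. x \<in> X \<Longrightarrow> \<bar>\<phi> x\<bar> \<le> 1"
  shows "(\<Sum>x\<in>X. p x * \<phi> x) - (\<Sum>x\<in>X. g x * \<phi> x) \<le> sqrt ((\<Sum>x\<in>X. (g x)\<^sup>2 / p x) - 1)"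
proof -
  have "(\<Sum>x\<in>X. p x * \<phi> x) - (\<Sum>x\<in>X. g x * \<phi> x) = (\<Sum>x\<in>X. (p x - g x) * \<phi> x)"
    by (simp add: sum_subtractf algebra_simps)
  also have "\<dots> \<le> (\<Sum>x\<in>X. \<bar>p x - g x\<bar>)"
  proof (rule sum_mono)
    fix x assume "x \<in> X"
    have "(p x - g x) * \<phi> x \<le> \<bar>p x - g x\<bar> * \<bar>\<phi> x\<bar>"
      by (metis abs_ge_self abs_mult)
    also have "\<dots> \<le> \<bar>p x - g x\<bar> * 1"
      using \<phi>[OF \<open>x \<in> X\<close>] by (intro mult_left_mono) auto
    finally show "(p x - g x) * \<phi> x \<le> \<bar>p x - g x\<bar>" by simp
  qed
  also have "\<dots> \<le> sqrt ((\<Sum>x\<in>X. (g x)\<^sup>2 / p x) - 1)"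
  proof (rule real_le_rsqrt)
    have "(\<Sum>x\<in>X. \<bar>p x - g x\<bar>) = (\<Sum>x\<in>X. sqrt (p x) * (\<bar>p x - g x\<bar> / sqrt (p x)))"
      using p(1) by (intro sum.cong) (auto simp: less_imp_neq[symmetric])
    then have "(\<Sum>x\<in>X. \<bar>p x - g x\<bar>)\<^sup>2
        \<le> (\<Sum>x\<in>X. (sqrt (p x))\<^sup>2) * (\<Sum>x\<in>X. (\<bar>p x - g x\<bar> / sqrt (p x))\<^sup>2)"
      by (simp only: Cauchy_Schwarz_ineq_sum)
    also have "(\<Sum>x\<in>X. (sqrt (p x))\<^sup>2) = 1"
      using p by (simp add: less_imp_le)
    also have "(\<Sum>x\<in>X. (\<bar>p x - g x\<bar> / sqrt (p x))\<^sup>2) = (\<Sum>x\<in>X. p x - 2 * g x + (g x)\<^sup>2 / p x)"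
    proof (rule sum.cong[OF refl])
      fix x assume "x \<in> X"
      with p(1) have "p x > 0" by auto
      then show "(\<bar>p x - g x\<bar> / sqrt (p x))\<^sup>2 = p x - 2 * g x + (g x)\<^sup>2 / p x"
        by (simp add: power_divide field_simps power2_eq_square)
    qed
    also have "\<dots> = (\<Sum>x\<in>X. (g x)\<^sup>2 / p x) - 1"
      by (simp add: sum.distrib sum_subtractf p(2) g flip: sum_distrib_left)
    finally show "(\<Sum>x\<in>X. \<bar>p x - g x\<bar>)\<^sup>2 \<le> (\<Sum>x\<in>X. (g x)\<^sup>2 / p x) - 1" by simp
  qed
  finally show ?thesis .
qed

section \<open>The multinomial law as a finite sum\<close>

lemma multinomial_law_eq_point_measure:
  assumes "q \<in> prob_simplex d"
  shows "multinomial_law n d q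
    = point_measure ({1..n} \<rightarrow>\<^sub>E {1..d}) (\<lambda>x. ennreal (\<Prod>k=1..n. q (x k)))"
proof -
  let ?M = "\<lambda>_::nat. point_measure {1..d} (\<lambda>i. ennreal (q i))"
  let ?X = "{1..n} \<rightarrow>\<^sub>E {1..d}"
  interpret P: prob_space "?M i" for i
    by (rule prob_simplex_point_measure[OF assms])
  interpret product_sigma_finite ?M
    by unfold_locales
  have q0: "0 \<le> q i" if "i \<in> {1..d}" for i
    using assms that by (auto simp: prob_simplex_def PiE_def Pi_def)
  have "sets (PiM {1..n} ?M) = sets (PiM {1..n} (\<lambda>_. count_space {1..d}))"
    by (intro sets_PiM_cong) (auto simp: sets_point_measure)
  also have "\<dots> = Pow ?X"
    by (subst count_space_PiM_finite) auto
  finally have sets: "sets (PiM {1..n} ?M) = Pow ?X" .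
  show ?thesis
    unfolding multinomial_law_def
  proof (rule measure_eqI_finite[OF sets])
    show "sets (point_measure ?X (\<lambda>x. ennreal (\<Prod>k=1..n. q (x k)))) = Pow ?X"
      by (simp add: sets_point_measure)
    show "finite ?X" by (intro finite_PiE) auto
    fix x assume x: "x \<in> ?X"
    then have xi: "x k \<in> {1..d}" if "k \<in> {1..n}" for k
      using that by auto
    have "{x} = (\<Pi>\<^sub>E k\<in>{1..n}. {x k})"
      using x PiE_singleton[of x "{1..n}"] by (auto simp: PiE_def)
    then have "emeasure (PiM {1..n} ?M) {x} = (\<Prod>k=1..n. emeasure (?M k) {x k})"
      using xi by (simp only:) (intro emeasure_PiM, auto simp: sets_point_measure)
    also have "\<dots> = (\<Prod>k=1..n. ennreal (q (x k)))"
      using xi by (intro prod.cong) (auto simp: emeasure_point_measure_finite)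
    also have "\<dots> = ennreal (\<Prod>k=1..n. q (x k))"
      using xi q0 by (intro prod_ennreal) auto
    also have "\<dots> = emeasure (point_measure ?X (\<lambda>x. ennreal (\<Prod>k=1..n. q (x k)))) {x}"
      using x \<open>finite ?X\<close> by (simp add: emeasure_point_measure_finite)
    finally show "emeasure (PiM {1..n} ?M) {x}
        = emeasure (point_measure ?X (\<lambda>x. ennreal (\<Prod>k=1..n. q (x k)))) {x}" .
  qed
qed

text \<open>
  The sample space is finite, so tests of the multinomial experiment have explicit expectations.
\<close>
lemma integral_multinomial_law:
  fixes \<phi> :: "_ \<Rightarrow> real"
  assumes "q \<in> prob_simplex d"
  shows "integral\<^sup>L (multinomial_law n d q) \<phi>
    = (\<Sum>x\<in>{1..n} \<rightarrow>\<^sub>E {1..d}. (\<Prod>k=1..n. q (x k)) * \<phi> x)"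
proof -
  have "0 \<le> (\<Prod>k=1..n. q (x k))" if "x \<in> {1..n} \<rightarrow>\<^sub>E {1..d}" for x
    using assms that by (intro prod_nonneg) (fastforce simp: prob_simplex_def PiE_def Pi_def)
  then show ?thesis
    unfolding multinomial_law_eq_point_measure[OF assms]
    by (subst lebesgue_integral_point_measure_finite) (auto intro!: finite_PiE)
qed

section \<open>Antipodal perturbations of the uniform distribution\<close>

text \<open>
  Coordinates \<open>i\<close> and \<open>i + m\<close> receive opposite signs, so that perturbing along this
  direction preserves the total mass; what lies beyond \<open>2 * m\<close> (one coordinate when the dimension
  is odd) stays untouched.
\<close>
definition paired_signs :: "nat \<Rightarrow> (nat \<Rightarrow> real) \<Rightarrow> nat \<Rightarrow> real" where
  "paired_signs m s i = (if i \<le> m then s i else if i \<le> 2 * m then - s (i - m) else 0)"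

definition perturbed_uniform :: "nat \<Rightarrow> real \<Rightarrow> (nat \<Rightarrow> real) \<Rightarrow> nat \<Rightarrow> real" where
  "perturbed_uniform d e s = (\<lambda>i\<in>{1..d}. (1 + e * paired_signs (d div 2) s i) / d)"

definition sign_vectors :: "nat \<Rightarrow> (nat \<Rightarrow> real) set" where
  "sign_vectors m = {1..m} \<rightarrow>\<^sub>E {-1, 1}"

lemma sum_over_pairs:
  fixes F :: "nat \<Rightarrow> real"
  assumes "2 * m \<le> d"
  shows "(\<Sum>i=1..d. F i) = (\<Sum>j=1..m. F j + F (j + m)) + (\<Sum>i=2*m+1..d. F i)"
proof -
  have "{1..d} = {1..m} \<union> {m+1..m+m} \<union> {2*m+1..d}"
    using assms by auto
  then have "(\<Sum>i=1..d. F i) = (\<Sum>i=1..m. F i) + (\<Sum>i=m+1..m+m. F i) + (\<Sum>i=2*m+1..d. F i)"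
    by (simp only:) (subst sum.union_disjoint; auto simp: sum.union_disjoint)+
  also have "(\<Sum>i=m+1..m+m. F i) = (\<Sum>j=1..m. F (j + m))"
    using sum.shift_bounds_cl_nat_ivl[of F 1 m m] by (simp add: add.commute)
  finally show ?thesis by (simp add: sum.distrib)
qed

text \<open>
  Every sum over coordinates that matters below, be it total mass, sum of square roots or inner
  product of two perturbations, has this form.
\<close>
lemma sum_paired_signs:
  fixes G :: "real \<Rightarrow> real \<Rightarrow> real"
  assumes "2 * m \<le> d"
  shows "(\<Sum>i=1..d. G (paired_signs m s i) (paired_signs m t i))
    = (\<Sum>j=1..m. G (s j) (t j) + G (- s j) (- t j)) + (real d - 2 * real m) * G 0 0"
  unfolding sum_over_pairs[OF assms]
proof (rule arg_cong2[where f="(+)"])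
  show "(\<Sum>j=1..m. G (paired_signs m s j) (paired_signs m t j)
        + G (paired_signs m s (j + m)) (paired_signs m t (j + m)))
      = (\<Sum>j=1..m. G (s j) (t j) + G (- s j) (- t j))"
    by (intro sum.cong) (auto simp: paired_signs_def)
  have "(\<Sum>i=2*m+1..d. G (paired_signs m s i) (paired_signs m t i)) = (\<Sum>i=2*m+1..d. G 0 0)"
    by (intro sum.cong) (auto simp: paired_signs_def)
  then show "(\<Sum>i=2*m+1..d. G (paired_signs m s i) (paired_signs m t i)) = (real d - 2 * real m) * G 0 0"
    using assms by simp
qed

lemma paired_signs_bound:
  assumes "s \<in> sign_vectors m" "1 \<le> i"
  shows "\<bar>paired_signs m s i\<bar> \<le> 1"
proof -
  have *: "\<bar>s j\<bar> \<le> 1" if "j \<in> {1..m}" for j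
    using assms(1) PiE_mem[of s "{1..m}" "\<lambda>_. {-1, 1}" j] that by (auto simp: sign_vectors_def)
  consider "i \<le> m" | "m < i" "i \<le> 2 * m" | "2 * m < i" by linarith
  then show ?thesis
  proof cases
    case 2
    then have "i - m \<in> {1..m}" by auto
    then show ?thesis using 2 * by (simp add: paired_signs_def)
  qed (use *[of i] assms(2) in \<open>auto simp: paired_signs_def\<close>)
qed

lemma sum_perturbed_uniform:
  assumes "0 < d"
  shows "(\<Sum>i=1..d. perturbed_uniform d e s i) = 1"
proof -
  have "(\<Sum>i=1..d. perturbed_uniform d e s i)
      = (\<Sum>i=1..d. 1 + e * paired_signs (d div 2) s i) / d"
    by (simp add: perturbed_uniform_def sum_divide_distrib)
  also have "(\<Sum>i=1..d. 1 + e * paired_signs (d div 2) s i) = d"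
    using sum_paired_signs[of "d div 2" d "\<lambda>x _. 1 + e * x" s s] by simp
  finally show ?thesis using assms by simp
qed

lemma perturbed_uniform_in_bounded_ratio_simplex:
  assumes s: "s \<in> sign_vectors (d div 2)" and d: "0 < d" and e: "0 \<le> e" "e < 1"
    and R: "(1 + e) / (1 - e) \<le> R"
  shows "perturbed_uniform d e s \<in> bounded_ratio_simplex R d"
proof -
  let ?q = "perturbed_uniform d e s"
  have b: "(1 - e) / d \<le> ?q i \<and> ?q i \<le> (1 + e) / d" if "i \<in> {1..d}" for i
  proof -
    have "\<bar>e * paired_signs (d div 2) s i\<bar> \<le> e * 1"
      using paired_signs_bound[OF s, of i] that e unfolding abs_mult
      by (intro mult_mono) auto
    then show ?thesis
      using that d by (auto simp: perturbed_uniform_def divide_right_mono)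
  qed
  have pos: "0 < ?q i" if "i \<in> {1..d}" for i
  proof -
    have "0 < (1 - e) / d" using d e by simp
    then show ?thesis using b[OF that] by linarith
  qed
  have ne: "?q ` {1..d} \<noteq> {}" using d by auto
  have Min: "(1 - e) / d \<le> Min (?q ` {1..d})"
    using b ne by (subst Min_ge_iff) auto
  have Max: "Max (?q ` {1..d}) \<le> (1 + e) / d"
    using b ne by (subst Max_le_iff) auto
  have "0 < (1 - e) / d" using d e by simp
  then have "Max (?q ` {1..d}) / Min (?q ` {1..d}) \<le> ((1 + e) / d) / ((1 - e) / d)"
    using Min Max e by (intro frac_le) auto
  also have "\<dots> \<le> R" using d R by simp
  finally have ratio: "Max (?q ` {1..d}) / Min (?q ` {1..d}) \<le> R" .
  \<comment> \<open>A nonnegative weight is at most the total weight, which is one.\<close>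
  have "?q i \<le> 1" if "i \<in> {1..d}" for i
    using member_le_sum[of i "{1..d}" ?q] pos that sum_perturbed_uniform[OF d, of e s]
    by (force intro: less_imp_le)
  moreover have "?q \<in> extensional {1..d}"
    by (simp add: perturbed_uniform_def)
  ultimately have "?q \<in> prob_simplex d"
    using pos sum_perturbed_uniform[OF d, of e s]
    by (auto simp: prob_simplex_def PiE_def Pi_def less_imp_le)
  then show ?thesis
    using ratio Min \<open>0 < (1 - e) / d\<close> by (auto simp: bounded_ratio_simplex_def)
qed

text \<open>
  A quantitative form of the strict concavity of the square root. It is the source of the signal
  in the Gaussian experiment.
\<close>
lemma sqrt_add_sqrt_le:
  fixes e :: real
  assumes "0 \<le> e" "e \<le> 1"
  shows "sqrt (1 + e) + sqrt (1 - e) \<le> 2 - e\<^sup>2 / 4"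
proof -
  let ?u = "sqrt (1 + e) + sqrt (1 - e)"
  have p: "sqrt (1 + e) * sqrt (1 - e) = sqrt (1 - e\<^sup>2)"
    by (simp add: power2_eq_square algebra_simps flip: real_sqrt_mult)
  have e2: "e\<^sup>2 \<le> 1"
    using assms by (simp add: power_le_one)
  have "sqrt (1 - e\<^sup>2) \<le> 1 - e\<^sup>2 / 2"
  proof (rule real_le_lsqrt)
    have "(1 - e\<^sup>2 / 2)\<^sup>2 = 1 - e\<^sup>2 + (e\<^sup>2 / 2)\<^sup>2"
      by (simp add: power2_diff)
    then show "1 - e\<^sup>2 \<le> (1 - e\<^sup>2 / 2)\<^sup>2"
      using zero_le_power2[of "e\<^sup>2 / 2"] by linarith
  qed (use e2 in auto)
  moreover have "?u\<^sup>2 = 2 + 2 * sqrt (1 - e\<^sup>2)"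
    using assms by (simp add: power2_sum p mult.assoc)
  ultimately have "?u\<^sup>2 \<le> 4 - e\<^sup>2" by linarith
  also have "\<dots> \<le> (2 - e\<^sup>2 / 4)\<^sup>2"
  proof -
    have "(2 - e\<^sup>2 / 4)\<^sup>2 = 4 - e\<^sup>2 + (e\<^sup>2 / 4)\<^sup>2"
      by (simp add: power2_diff)
    then show ?thesis
      using zero_le_power2[of "e\<^sup>2 / 4"] by linarith
  qed
  finally show ?thesis
    by (rule power2_le_imp_le) (use e2 in linarith)
qed

text \<open>
  Concavity lowers each pair by at least \<open>e\<^sup>2 / 4\<close> before the division by \<open>sqrt d\<close>, and
  there are at least \<open>d / 3\<close> pairs, the worst case being \<open>d = 3\<close>. All perturbations shift the sum
  of the Gaussian means downwards, whatever their signs, so one threshold test detects all of them.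
\<close>
lemma sum_sqrt_perturbed_uniform_le:
  assumes s: "s \<in> sign_vectors (d div 2)" and d: "2 \<le> d" and e: "0 \<le> e" "e \<le> 1"
  shows "(\<Sum>i=1..d. sqrt (perturbed_uniform d e s i)) \<le> sqrt d - sqrt d * e\<^sup>2 / 12"
proof -
  define m where "m = d div 2"
  have m: "2 * m \<le> d" "d \<le> 3 * m"
    using d by (auto simp: m_def)
  have "(\<Sum>i=1..d. sqrt (1 + e * paired_signs m s i))
      = (\<Sum>j=1..m. sqrt (1 + e * s j) + sqrt (1 + e * (- s j))) + (real d - 2 * real m)"
    using sum_paired_signs[OF m(1), of "\<lambda>x _. sqrt (1 + e * x)" s s] by simp
  moreover have "(\<Sum>j=1..m. sqrt (1 + e * s j) + sqrt (1 + e * (- s j)))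
      \<le> (\<Sum>j=1..m. 2 - e\<^sup>2 / 4)"
  proof (rule sum_mono)
    fix j assume "j \<in> {1..m}"
    then have "s j = 1 \<or> s j = -1"
      using s by (auto simp: sign_vectors_def m_def PiE_def Pi_def)
    then show "sqrt (1 + e * s j) + sqrt (1 + e * (- s j)) \<le> 2 - e\<^sup>2 / 4"
      using sqrt_add_sqrt_le[OF e] by auto
  qed
  moreover have "(\<Sum>j=1..m. 2 - e\<^sup>2 / 4) = 2 * real m - real m * (e\<^sup>2 / 4)"
    by (simp add: algebra_simps)
  moreover have "real d / 3 * (e\<^sup>2 / 4) \<le> real m * (e\<^sup>2 / 4)"
    using m by (intro mult_right_mono) auto
  ultimately have bound: "(\<Sum>i=1..d. sqrt (1 + e * paired_signs m s i)) \<le> d * (1 - e\<^sup>2 / 12)"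
    by (simp add: algebra_simps)
  have "(\<Sum>i=1..d. sqrt (perturbed_uniform d e s i))
      = (\<Sum>i=1..d. sqrt (1 + e * paired_signs m s i)) / sqrt d"
    by (simp add: perturbed_uniform_def real_sqrt_divide sum_divide_distrib m_def)
  also have "\<dots> \<le> d * (1 - e\<^sup>2 / 12) / sqrt d"
    using bound by (rule divide_right_mono) simp
  also have "\<dots> = (d / sqrt d) * (1 - e\<^sup>2 / 12)"
    by simp
  also have "\<dots> = sqrt d - sqrt d * e\<^sup>2 / 12"
    unfolding real_div_sqrt[OF of_nat_0_le_iff] by (simp add: algebra_simps)
  finally show ?thesis .
qed

section \<open>Indistinguishability from multinomial draws\<close>

text \<open>
  The moment generating function of a sum of independent random signs factorises.
\<close>
lemma sum_exp_inner_sign_vectors: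
  assumes "s \<in> sign_vectors m"
  shows "(\<Sum>t\<in>sign_vectors m. exp (c * (\<Sum>j=1..m. s j * t j))) = (2 * cosh c) ^ m"
proof -
  have "(\<Sum>t\<in>sign_vectors m. exp (c * (\<Sum>j=1..m. s j * t j)))
      = (\<Sum>t\<in>sign_vectors m. \<Prod>j=1..m. exp (c * (s j * t j)))"
    by (simp add: sum_distrib_left exp_sum)
  also have "\<dots> = (\<Prod>j=1..m. \<Sum>x\<in>{-1, 1}. exp (c * (s j * x)))"
    unfolding sign_vectors_def by (subst prod_sum_PiE) auto
  also have "\<dots> = (\<Prod>j=1..m. 2 * cosh c)"
  proof (rule prod.cong[OF refl])
    fix j assume "j \<in> {1..m}"
    then have "s j = 1 \<or> s j = -1"
      using assms by (auto simp: sign_vectors_def PiE_def Pi_def)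
    then show "(\<Sum>x\<in>{-1, 1}. exp (c * (s j * x))) = 2 * cosh c"
      by (auto simp: cosh_def scaleR_conv_of_real)
  qed
  finally show ?thesis by simp
qed

text \<open>
  A cruder exponent than the optimal \<open>c\<^sup>2 / 2\<close>, which costs only a constant factor.
\<close>
lemma cosh_le_exp_square:
  fixes c :: real
  assumes "0 \<le> c" "c \<le> 1"
  shows "cosh c \<le> exp (c\<^sup>2)"
proof -
  have "exp c \<le> 1 + c + c\<^sup>2"
    using assms by (rule exp_bound)
  moreover have "exp (- c) \<le> 1 - c + c\<^sup>2"
  proof -
    \<comment> \<open>The right side equals \<open>1 + c ^ 3\<close>.\<close>
    have "1 \<le> (1 - c + c\<^sup>2) * (1 + c)"
      using assms by (simp add: algebra_simps power2_eq_square)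
    also have "\<dots> \<le> (1 - c + c\<^sup>2) * exp c"
      using assms by (intro mult_left_mono exp_ge_add_one_self) (auto simp: add_nonneg_nonneg)
    finally show ?thesis
      by (simp add: exp_minus field_simps)
  qed
  ultimately have "cosh c \<le> 1 + c\<^sup>2"
    by (simp add: cosh_def)
  then show ?thesis
    using exp_ge_add_one_self[of "c\<^sup>2"] by linarith
qed

text \<open>
  The left side is one plus the chi-square divergence of the mixture from the uniform law (the
  second-moment method of Ingster). For fixed sign vectors \<open>s\<close> and \<open>t\<close> the product structure
  of the laws gives \<open>(1 + 2 * e\<^sup>2 / d * (\<Sum>j. s j * t j)) ^ n\<close>, at most an exponential of the
  inner product; averaging over \<open>t\<close> produces a power of \<open>cosh (2 * e\<^sup>2 * n / d)\<close>.
\<close>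
lemma second_moment_perturbed_mixture:
  fixes d n :: nat and e :: real
  assumes d: "0 < d" and e: "0 \<le> e" "e \<le> 1" and small: "2 * e\<^sup>2 * n \<le> d"
  defines "S \<equiv> sign_vectors (d div 2)"
  defines "L \<equiv> (\<lambda>s x. \<Prod>k=1..n. perturbed_uniform d e s (x k))"
  shows "(\<Sum>x\<in>{1..n} \<rightarrow>\<^sub>E {1..d}. ((\<Sum>s\<in>S. L s x) / card S)\<^sup>2 / (1 / d) ^ n)
    \<le> exp (2 * e ^ 4 * n\<^sup>2 / d)"
proof -
  let ?X = "{1..n} \<rightarrow>\<^sub>E {1..d}"
  define m where "m = d div 2"
  define c where "c = 2 * e\<^sup>2 * n / d"
  have m: "2 * m \<le> d" by (simp add: m_def)
  have Sm: "S = sign_vectors m" by (simp add: S_def m_def)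
  have cardS: "real (card S) = 2 ^ m"
    by (simp add: Sm sign_vectors_def card_PiE)
  have c: "0 \<le> c" "c \<le> 1"
    using d e small by (auto simp: c_def divide_simps)
  have pair: "(\<Sum>x\<in>?X. L s x * L t x / (1 / d) ^ n) \<le> exp (c * (\<Sum>j=1..m. s j * t j))"
    if "s \<in> S" "t \<in> S" for s t
  proof -
    let ?a = "\<lambda>i. perturbed_uniform d e s i * perturbed_uniform d e t i * d"
    have nonneg: "0 \<le> perturbed_uniform d e u i" if "u \<in> S" "i \<in> {1..d}" for u i
    proof -
      have "\<bar>e * paired_signs m u i\<bar> \<le> 1 * 1"
        using paired_signs_bound[of u m i] that e unfolding abs_mult Sm
        by (intro mult_mono) auto
      then show ?thesis
        using that by (auto simp: perturbed_uniform_def m_def)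
    qed
    \<comment> \<open>The terms linear in \<open>e\<close> cancel within each pair; only the inner product survives.\<close>
    have "(\<Sum>i=1..d. ?a i)
        = (\<Sum>i=1..d. (1 + e * paired_signs m s i) * (1 + e * paired_signs m t i)) / d"
      using d by (simp add: perturbed_uniform_def m_def sum_divide_distrib)
    also have "(\<Sum>i=1..d. (1 + e * paired_signs m s i) * (1 + e * paired_signs m t i))
        = (\<Sum>j=1..m. 2 + 2 * e\<^sup>2 * (s j * t j)) + (real d - 2 * real m)"
      using sum_paired_signs[OF m, of "\<lambda>x y. (1 + e * x) * (1 + e * y)" s t]
      by (simp add: algebra_simps power2_eq_square)
    also have "(\<Sum>j=1..m. 2 + 2 * e\<^sup>2 * (s j * t j)) = 2 * m + 2 * e\<^sup>2 * (\<Sum>j=1..m. s j * t j)"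
      by (simp add: sum.distrib sum_distrib_left)
    also have "(2 * m + 2 * e\<^sup>2 * (\<Sum>j=1..m. s j * t j) + (real d - 2 * real m)) / d
        = 1 + 2 * e\<^sup>2 / d * (\<Sum>j=1..m. s j * t j)"
      using d by (simp add: field_simps)
    finally have base: "(\<Sum>i=1..d. ?a i) = 1 + 2 * e\<^sup>2 / d * (\<Sum>j=1..m. s j * t j)" .
    have "(\<Sum>x\<in>?X. L s x * L t x / (1 / d) ^ n) = (\<Sum>x\<in>?X. \<Prod>k=1..n. ?a (x k))"
      by (intro sum.cong) (auto simp: L_def prod.distrib power_one_over)
    also have "\<dots> = (\<Prod>k=1..n. \<Sum>i=1..d. ?a i)"
      by (subst prod_sum_PiE) auto
    also have "\<dots> = (\<Sum>i=1..d. ?a i) ^ n"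
      by simp
    finally have eq: "(\<Sum>x\<in>?X. L s x * L t x / (1 / d) ^ n)
        = (1 + 2 * e\<^sup>2 / d * (\<Sum>j=1..m. s j * t j)) ^ n"
      unfolding base .
    \<comment> \<open>Raising \<open>1 + y \<le> exp y\<close> to a power needs the left side to be nonnegative.\<close>
    have "0 \<le> (\<Sum>i=1..d. ?a i)"
      by (intro sum_nonneg mult_nonneg_nonneg nonneg that) auto
    then have "(1 + 2 * e\<^sup>2 / d * (\<Sum>j=1..m. s j * t j)) ^ n
        \<le> exp (2 * e\<^sup>2 / d * (\<Sum>j=1..m. s j * t j)) ^ n"
      unfolding base by (intro power_mono exp_ge_add_one_self)
    also have "\<dots> = exp (c * (\<Sum>j=1..m. s j * t j))"
      unfolding exp_of_nat_mult[symmetric] c_def by (simp add: ac_simps)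
    finally show ?thesis unfolding eq .
  qed
  have "(\<Sum>x\<in>?X. ((\<Sum>s\<in>S. L s x) / card S)\<^sup>2 / (1 / d) ^ n)
      = (\<Sum>x\<in>?X. (\<Sum>s\<in>S. \<Sum>t\<in>S. L s x * L t x / (1 / d) ^ n) / (card S)\<^sup>2)"
  proof (rule sum.cong[OF refl])
    fix x
    have "((\<Sum>s\<in>S. L s x) / card S)\<^sup>2 / (1 / d) ^ n
        = ((\<Sum>s\<in>S. \<Sum>t\<in>S. L s x * L t x) / (1 / d) ^ n) / (card S)\<^sup>2"
      by (simp only: power_divide power2_eq_square[of "\<Sum>s\<in>S. L s x"] sum_product) simp
    then show "((\<Sum>s\<in>S. L s x) / card S)\<^sup>2 / (1 / d) ^ n
        = (\<Sum>s\<in>S. \<Sum>t\<in>S. L s x * L t x / (1 / d) ^ n) / (card S)\<^sup>2"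
      by (simp only: sum_divide_distrib)
  qed
  also have "\<dots> = (\<Sum>x\<in>?X. \<Sum>s\<in>S. \<Sum>t\<in>S. L s x * L t x / (1 / d) ^ n) / (card S)\<^sup>2"
    by (simp only: sum_divide_distrib)
  \<comment> \<open>Squaring the mixture turns it into an average over two independent sign vectors.\<close>
  also have "(\<Sum>x\<in>?X. \<Sum>s\<in>S. \<Sum>t\<in>S. L s x * L t x / (1 / d) ^ n)
      = (\<Sum>s\<in>S. \<Sum>t\<in>S. \<Sum>x\<in>?X. L s x * L t x / (1 / d) ^ n)"
    by (subst sum.swap) (intro sum.cong refl sum.swap)
  also have "\<dots> \<le> (\<Sum>s\<in>S. \<Sum>t\<in>S. exp (c * (\<Sum>j=1..m. s j * t j)))"
    by (intro sum_mono pair)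
  also have "\<dots> = (\<Sum>s\<in>S. (2 * cosh c) ^ m)"
    unfolding Sm by (intro sum.cong refl sum_exp_inner_sign_vectors)
  also have "\<dots> / (card S)\<^sup>2 = cosh c ^ m"
    by (simp add: cardS power_mult_distrib power2_eq_square)
  also have "\<dots> \<le> exp (c\<^sup>2) ^ m"
    using c cosh_le_exp_square by (intro power_mono) auto
  also have "\<dots> = exp (m * c\<^sup>2)"
    by (simp add: exp_of_nat_mult)
  also have "m * c\<^sup>2 \<le> d / 2 * c\<^sup>2"
    using m by (intro mult_right_mono) auto
  also have "d / 2 * c\<^sup>2 = 2 * e ^ 4 * n\<^sup>2 / d"
    using d by (simp add: c_def power_divide power_mult_distrib power2_eq_square eval_nat_numeral)
  finally show ?thesis
    by (simp add: divide_right_mono)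
qed

text \<open>
  The uniform law and the mixture of its perturbations are nearly indistinguishable from
  \<open>n\<close> draws when \<open>e\<^sup>2 * n\<close> is small compared with the square root of \<open>d\<close>.
\<close>
lemma multinomial_perturbed_mixture_tests:
  fixes d n :: nat and e :: real
  assumes d: "0 < d" and e: "0 \<le> e" "e < 1" and small: "2 * e\<^sup>2 * n \<le> d"
    and \<phi>: "\<And>x. 0 \<le> \<phi> x \<and> \<phi> x \<le> (1 :: real)"
  defines "S \<equiv> sign_vectors (d div 2)"
  shows "integral\<^sup>L (multinomial_law n d (\<lambda>i\<in>{1..d}. 1 / d)) \<phi>
      - (\<Sum>s\<in>S. integral\<^sup>L (multinomial_law n d (perturbed_uniform d e s)) \<phi>) / card S
    \<le> sqrt (exp (2 * e ^ 4 * n\<^sup>2 / d) - 1)"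
proof -
  let ?X = "{1..n} \<rightarrow>\<^sub>E {1..d}"
  let ?p = "\<lambda>x :: nat \<Rightarrow> nat. (1 / real d) ^ n"
  define L where "L = (\<lambda>s x. \<Prod>k=1..n. perturbed_uniform d e s (x k))"
  define g where "g = (\<lambda>x. (\<Sum>s\<in>S. L s x) / card S)"
  have S: "finite S" "S \<noteq> {}"
    by (auto simp: S_def sign_vectors_def PiE_eq_empty_iff intro!: finite_PiE)
  have simplex: "perturbed_uniform d e s \<in> prob_simplex d" if "s \<in> S" for s
    using perturbed_uniform_in_bounded_ratio_simplex[OF _ d e order_refl] that
    by (auto simp: bounded_ratio_simplex_def S_def)
  have unif: "(\<lambda>i\<in>{1..d}. 1 / real d) \<in> prob_simplex d"
    using uniform_in_bounded_ratio_simplex[OF order_refl d] by (simp add: bounded_ratio_simplex_def)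
  have sum_L: "(\<Sum>x\<in>?X. L s x) = 1" for s
    using prod_sum_PiE[of "{1..n}" "\<lambda>_. {1..d}" "\<lambda>_. perturbed_uniform d e s"]
    by (simp add: L_def sum_perturbed_uniform[OF d, simplified])
  have "(\<Sum>x\<in>?X. g x) = (\<Sum>s\<in>S. \<Sum>x\<in>?X. L s x) / card S"
    unfolding g_def by (subst sum.swap) (simp add: sum_divide_distrib)
  then have sum_g: "(\<Sum>x\<in>?X. g x) = 1"
    using S by (simp only: sum_L) simp
  have null: "integral\<^sup>L (multinomial_law n d (\<lambda>i\<in>{1..d}. 1 / d)) \<phi> = (\<Sum>x\<in>?X. ?p x * \<phi> x)"
    unfolding integral_multinomial_law[OF unif]
  proof (rule sum.cong[OF refl])
    fix x assume "x \<in> ?X"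
    then have "(\<Prod>k=1..n. (\<lambda>i\<in>{1..d}. 1 / real d) (x k)) = (\<Prod>k=1..n. 1 / real d)"
      by (intro prod.cong) auto
    then show "(\<Prod>k=1..n. (\<lambda>i\<in>{1..d}. 1 / real d) (x k)) * \<phi> x = ?p x * \<phi> x" by simp
  qed
  have "(\<Sum>s\<in>S. integral\<^sup>L (multinomial_law n d (perturbed_uniform d e s)) \<phi>)
      = (\<Sum>s\<in>S. \<Sum>x\<in>?X. L s x * \<phi> x)"
    using simplex by (intro sum.cong) (auto simp: integral_multinomial_law L_def)
  also have "\<dots> = (\<Sum>x\<in>?X. \<Sum>s\<in>S. L s x * \<phi> x)"
    by (rule sum.swap)
  finally have alt: "(\<Sum>s\<in>S. integral\<^sup>L (multinomial_law n d (perturbed_uniform d e s)) \<phi>) / card S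
      = (\<Sum>x\<in>?X. g x * \<phi> x)"
    by (simp add: g_def sum_distrib_right sum_divide_distrib)
  have card_X: "card ?X = d ^ n"
    by (simp add: card_PiE)
  have "(\<Sum>x\<in>?X. ?p x * \<phi> x) - (\<Sum>x\<in>?X. g x * \<phi> x) \<le> sqrt ((\<Sum>x\<in>?X. (g x)\<^sup>2 / ?p x) - 1)"
  proof (rule chi_square_test_bound)
    show "finite ?X" by (intro finite_PiE) auto
    show "(\<Sum>x\<in>?X. ?p x) = 1"
      using d unfolding sum_constant card_X by (simp add: power_one_over)
  qed (use d \<phi> sum_g in auto)
  also have "\<dots> \<le> sqrt (exp (2 * e ^ 4 * n\<^sup>2 / d) - 1)"
    using second_moment_perturbed_mixture[OF d e(1) less_imp_le[OF e(2)] small]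
    by (simp add: g_def L_def S_def)
  finally show ?thesis by (simp only: null alt)
qed

section \<open>The sum of the Gaussian coordinates\<close>

text \<open>
  Chebyshev's inequality: the sum of the coordinates has mean zero and variance \<open>d\<close>.
\<close>
lemma sum_std_gaussian_deviation:
  assumes "0 < d" "0 < r"
  shows "measure (std_gaussian d) {z \<in> space (std_gaussian d). r \<le> \<bar>\<Sum>i=1..d. z i\<bar>} \<le> real d / r\<^sup>2"
proof -
  let ?N = "density lborel (\<lambda>x. ennreal (std_normal_density x))"
  let ?W = "\<lambda>z :: nat \<Rightarrow> real. \<Sum>i=1..d. z i"
  have N: "prob_space ?N"
    by (rule prob_space_normal_density) simp
  interpret prob_space "std_gaussian d"
    unfolding std_gaussian_def by (intro prob_space_PiM N)
  have comp: "distr (std_gaussian d) borel (\<lambda>z. z i) = ?N" if "i \<in> {1..d}" for i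
  proof -
    have "distr (std_gaussian d) borel (\<lambda>z. z i) = distr (std_gaussian d) ?N (\<lambda>z. z i)"
      by (rule distr_cong) auto
    also have "\<dots> = ?N"
      unfolding std_gaussian_def using that by (intro distr_PiM_component N)
    finally show ?thesis .
  qed
  have rv: "random_variable borel (\<lambda>z. z i)" if "i \<in> {1..d}" for i
    using that unfolding std_gaussian_def
    by (auto intro!: measurable_compose[OF measurable_component_singleton])
  have "indep_vars (\<lambda>_. borel) (\<lambda>i z. z i) {1..d}"
  proof (subst indep_vars_iff_distr_eq_PiM')
    show "{1..d} \<noteq> {}" using assms by auto
    have "distr (std_gaussian d) (PiM {1..d} (\<lambda>_. borel)) (\<lambda>z. \<lambda>i\<in>{1..d}. z i)
        = distr (std_gaussian d) (std_gaussian d) (\<lambda>z. z)"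
      by (rule distr_cong)
        (auto simp: std_gaussian_def space_PiM PiE_def intro!: sets_PiM_cong extensional_restrict)
    also have "\<dots> = std_gaussian d" by (rule distr_id)
    also have "\<dots> = PiM {1..d} (\<lambda>i. distr (std_gaussian d) borel (\<lambda>z. z i))"
      by (subst (1) std_gaussian_def, intro PiM_cong) (auto simp: comp)
    finally show "distr (std_gaussian d) (PiM {1..d} (\<lambda>_. borel)) (\<lambda>z. \<lambda>i\<in>{1..d}. z i)
        = PiM {1..d} (\<lambda>i. distr (std_gaussian d) borel (\<lambda>z. z i))" .
  qed (use rv in auto)
  then have "distributed (std_gaussian d) lborel ?W
      (normal_density (\<Sum>i=1..d. 0) (sqrt (\<Sum>i=1..d. 1\<^sup>2)))"
    using assms rv comp
    by (intro sum_indep_normal) (auto simp: distributed_def cong: distr_cong)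
  then have W: "distributed (std_gaussian d) lborel ?W (normal_density 0 (sqrt d))"
    by simp
  have W_meas: "random_variable borel ?W"
    using rv by (intro borel_measurable_sum) auto
  have mean: "expectation ?W = 0"
    using normal_distributed_expectation[OF _ W] assms by simp
  have var: "variance ?W = d"
    using normal_distributed_variance[OF _ W] assms by simp
  have "variance ?W \<noteq> 0" using var assms by simp
  then have "integrable (std_gaussian d) (\<lambda>z. (?W z - expectation ?W)\<^sup>2)"
    using not_integrable_integral_eq by blast
  then have "integrable (std_gaussian d) (\<lambda>z. (?W z)\<^sup>2)"
    by (simp only: mean diff_zero)
  from Chebyshev_inequality[OF W_meas this \<open>0 < r\<close>] var show ?thesis
    by (simp only: mean diff_zero)
qed

text \<open>
  Under the Gaussian law the sum of the coordinates is its mean \<open>\<mu>\<close> plus a centred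
  variable of variance \<open>d / (2 * n)\<close>.
\<close>
lemma gaussian_law_sum_test:
  fixes a :: real and q :: "nat \<Rightarrow> real"
  assumes d: "0 < d" and n: "0 < n" and a: "a > 0"
  defines "\<mu> \<equiv> \<Sum>i=1..d. sqrt (q i)"
  shows "measure (gaussian_law n d q) {x \<in> space (euclidean_borel d). \<mu> + a \<le> (\<Sum>i=1..d. x i)}
      \<le> real d / (2 * real n * a\<^sup>2)" (is ?upper)
    and "measure (gaussian_law n d q) {x \<in> space (euclidean_borel d). \<mu> - a \<le> (\<Sum>i=1..d. x i)}
      \<ge> 1 - real d / (2 * real n * a\<^sup>2)" (is ?lower)
proof -
  define h where "h = (\<lambda>z :: nat \<Rightarrow> real. \<lambda>i\<in>{1..d}. sqrt (q i) + 1 / sqrt (2 * real n) * z i)"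
  let ?G = "std_gaussian d" and ?E = "\<lambda>t. {x \<in> space (euclidean_borel d). t \<le> (\<Sum>i=1..d. x i)}"
  define r where "r = sqrt (2 * real n) * a"
  interpret G: prob_space ?G
    unfolding std_gaussian_def by (intro prob_space_PiM prob_space_normal_density) simp
  have h: "h \<in> ?G \<rightarrow>\<^sub>M euclidean_borel d"
    unfolding h_def std_gaussian_def euclidean_borel_def
    by (intro measurable_restrict borel_measurable_add borel_measurable_times
        borel_measurable_const) (auto intro!: measurable_component_singleton
          measurable_compose[OF measurable_component_singleton])
  have sum_meas: "(\<lambda>z. \<Sum>i=1..d. z i) \<in> borel_measurable ?G"
    unfolding std_gaussian_def
    by (intro borel_measurable_sum) (auto intro!: measurable_compose[OF measurable_component_singleton])
  have E: "?E t \<in> sets (euclidean_borel d)" for t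
    unfolding euclidean_borel_def by measurable
  have r_pos: "0 < r" "r\<^sup>2 = 2 * real n * a\<^sup>2"
    using n a by (auto simp: r_def power_mult_distrib)
  have law: "measure (gaussian_law n d q) (?E t)
      = measure ?G {z \<in> space ?G. sqrt (2 * real n) * (t - \<mu>) \<le> (\<Sum>i=1..d. z i)}" for t
  proof -
    have "(\<Sum>i=1..d. h z i) = \<mu> + (\<Sum>i=1..d. z i) / sqrt (2 * real n)" for z
      by (simp add: h_def \<mu>_def sum.distrib sum_divide_distrib)
    moreover have "t \<le> \<mu> + w / sqrt (2 * real n) \<longleftrightarrow> sqrt (2 * real n) * (t - \<mu>) \<le> w" for w
      using n by (simp add: field_simps)
    ultimately have "h -` ?E t \<inter> space ?G
        = {z \<in> space ?G. sqrt (2 * real n) * (t - \<mu>) \<le> (\<Sum>i=1..d. z i)}"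
      using measurable_space[OF h] by auto
    then show ?thesis
      unfolding gaussian_law_def h_def[symmetric] by (simp only: measure_distr[OF h E])
  qed
  define T where "T = {z \<in> space ?G. r \<le> \<bar>\<Sum>i=1..d. z i\<bar>}"
  have T: "T \<in> sets ?G"
    unfolding T_def using sum_meas by measurable
  have tail: "measure ?G T \<le> real d / (2 * real n * a\<^sup>2)"
    using sum_std_gaussian_deviation[OF d r_pos(1)] r_pos(2) by (simp add: T_def)
  have eqs: "sqrt (2 * real n) * (\<mu> + a - \<mu>) = r" "sqrt (2 * real n) * (\<mu> - a - \<mu>) = - r"
    by (simp_all add: r_def)
  have "measure ?G {z \<in> space ?G. r \<le> (\<Sum>i=1..d. z i)} \<le> measure ?G T"
    using T by (intro G.finite_measure_mono) (auto simp: T_def)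
  with tail show ?upper
    unfolding law eqs by linarith
  have "{z \<in> space ?G. - r \<le> (\<Sum>i=1..d. z i)} \<in> sets ?G"
    using sum_meas by measurable
  then have "measure ?G (space ?G - T) \<le> measure ?G {z \<in> space ?G. - r \<le> (\<Sum>i=1..d. z i)}"
    by (intro G.finite_measure_mono) (auto simp: T_def not_le)
  then show ?lower
    using tail unfolding law eqs G.prob_compl[OF T] by linarith
qed

lemma sum_sqrt_uniform:
  assumes "0 < d"
  shows "(\<Sum>i=1..d. sqrt ((\<lambda>i\<in>{1..d}. 1 / real d) i)) = sqrt d"
proof -
  have "(\<Sum>i=1..d. sqrt ((\<lambda>i\<in>{1..d}. 1 / real d) i)) = (\<Sum>i=1..d. 1 / sqrt d)"
    by (intro sum.cong) (auto simp: real_sqrt_divide)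
  then show ?thesis
    using assms by (simp add: real_div_sqrt)
qed

section \<open>The lower bound on the deficiency\<close>

text \<open>
  The size \<open>e\<^sup>2 = 48 / sqrt n\<close> makes the drop of the Gaussian sum a fixed multiple of
  its standard deviation, so that the threshold test errs with probability at most \<open>1 / 8\<close> under
  each hypothesis. The divergence exponent of the multinomial mixture becomes \<open>4608 * n / d\<close>,
  and the assumed bound on \<open>n / d\<close> limits the gain of every multinomial test to \<open>1 / 4\<close>.
  What remains of the gain is \<open>7 / 8 - 1 / 8 - 1 / 4\<close>, and half of it bounds the deficiency.
\<close>
lemma deficiency_multinomial_gaussian_ge:
  fixes n d :: nat and R e :: real
  assumes d: "2 \<le> d" and n: "0 < n" and e_def: "e\<^sup>2 = 48 / sqrt n" and e: "0 < e" "e < 1"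
    and R: "(1 + e) / (1 - e) \<le> R" and nd: "150000 * real n \<le> d"
  shows "1 / 4 \<le> deficiency (bounded_ratio_simplex R d)
      (draws_space n d) (multinomial_law n d) (euclidean_borel d) (gaussian_law n d)"
proof -
  define S where "S = sign_vectors (d div 2)"
  define a where "a = sqrt d * e\<^sup>2 / 24"
  define E where "E = {x \<in> space (euclidean_borel d). sqrt d - a \<le> (\<Sum>i=1..d. x i)}"
  let ?F = "bounded_ratio_simplex R d" and ?u = "\<lambda>i\<in>{1..d}. 1 / real d"
  have d0: "0 < d" using d by simp
  have sets_E: "{x \<in> space (euclidean_borel d). t \<le> (\<Sum>i=1..d. x i)} \<in> sets (euclidean_borel d)" for t
    unfolding euclidean_borel_def by measurable
  have a0: "0 < a" using d e by (simp add: a_def)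
  \<comment> \<open>The shift of the mean is at least \<open>2 * a\<close>, so the threshold lies at distance at least \<open>a\<close>
    from both means; \<open>a\<close> is \<open>2 * sqrt 2\<close> standard deviations of the sum.\<close>
  have "a\<^sup>2 = 4 * d / n"
    using n by (simp add: a_def e_def power_divide power_mult_distrib)
  then have err: "real d / (2 * real n * a\<^sup>2) = 1 / 8"
    using n d by simp
  have simplex: "q \<in> prob_simplex d" if "q \<in> ?F" for q
    using that by (simp add: bounded_ratio_simplex_def)
  have "1 \<le> (1 + e) / (1 - e)"
    using e by simp
  with R have R1: "1 \<le> R" by linarith
  have e4: "e ^ 4 = 2304 / n"
  proof -
    have "e ^ 4 = (e\<^sup>2)\<^sup>2" by simp
    also have "\<dots> = 2304 / n" by (simp only: e_def) (simp add: power_divide)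
    finally show ?thesis .
  qed
  have "2 * e\<^sup>2 * n \<le> 2 * 1 * real n"
    using e by (intro mult_mono) (auto simp: power_le_one)
  then have small: "2 * e\<^sup>2 * n \<le> d"
    using nd by linarith
  have "2 * e ^ 4 * n\<^sup>2 / d = 4608 * real n / d"
    using n by (simp add: e4 power2_eq_square)
  also have "\<dots> \<le> 1 / 32"
    using nd d by (simp add: field_simps)
  finally have "exp (2 * e ^ 4 * n\<^sup>2 / d) \<le> 1 + 2 * (1 / 32)"
    using real_exp_bound_lemma[of "2 * e ^ 4 * n\<^sup>2 / d"] e by auto
  then have "sqrt (exp (2 * e ^ 4 * n\<^sup>2 / d) - 1) \<le> 1 / 4"
    by (intro real_le_lsqrt) (auto simp: power2_eq_square)
  note chi = this
  have "1 / 4 = (7 / 8 - 1 / 8 - 1 / 4) / (2 :: real)" by simp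
  also have "\<dots> \<le> deficiency ?F (draws_space n d) (multinomial_law n d)
      (euclidean_borel d) (gaussian_law n d)"
  proof (rule deficiency_ge_of_test[where h = ?u and S = S and g = "perturbed_uniform d e" and E = E])
    show "multinomial_law n d f \<in> space (prob_algebra (draws_space n d))" if "f \<in> ?F" for f
      using multinomial_law_in_prob_algebra[OF simplex[OF that]] .
    show "?u \<in> ?F"
      using uniform_in_bounded_ratio_simplex[OF R1 d0] .
    show "finite S" "S \<noteq> {}"
      by (auto simp: S_def sign_vectors_def PiE_eq_empty_iff intro!: finite_PiE)
    show "perturbed_uniform d e s \<in> ?F" if "s \<in> S" for s
      using perturbed_uniform_in_bounded_ratio_simplex[OF _ d0 _ _ R] that e by (simp add: S_def)
    show "E \<in> sets (euclidean_borel d)"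
      unfolding E_def by (rule sets_E)
    show "7 / 8 \<le> measure (gaussian_law n d ?u) E"
      using gaussian_law_sum_test(2)[OF d0 n a0, of ?u]
      unfolding sum_sqrt_uniform[OF d0] err by (simp add: E_def)
    show "measure (gaussian_law n d (perturbed_uniform d e s)) E \<le> 1 / 8" if s: "s \<in> S" for s
    proof -
      let ?q = "perturbed_uniform d e s"
      let ?U = "{x \<in> space (euclidean_borel d). (\<Sum>i=1..d. sqrt (?q i)) + a \<le> (\<Sum>i=1..d. x i)}"
      interpret prob_space "gaussian_law n d ?q"
        using gaussian_law_in_prob_algebra[of n d ?q] by (simp add: space_prob_algebra)
      have "(\<Sum>i=1..d. sqrt (?q i)) \<le> sqrt d - 2 * a"
        using sum_sqrt_perturbed_uniform_le[of s d e] s d e by (simp add: S_def a_def)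
      then have "E \<subseteq> ?U"
        unfolding E_def by auto
      then have "measure (gaussian_law n d ?q) E \<le> measure (gaussian_law n d ?q) ?U"
        using sets_E by (intro finite_measure_mono) (auto simp: gaussian_law_def)
      then show ?thesis
        using gaussian_law_sum_test(1)[OF d0 n a0, of ?q] unfolding err by linarith
    qed
    show "integral\<^sup>L (multinomial_law n d ?u) \<phi>
        - (\<Sum>s\<in>S. integral\<^sup>L (multinomial_law n d (perturbed_uniform d e s)) \<phi>) / card S \<le> 1 / 4"
      if "\<And>x. 0 \<le> \<phi> x \<and> \<phi> x \<le> 1" for \<phi> :: "(nat \<Rightarrow> nat) \<Rightarrow> real"
      unfolding S_def
      by (rule order_trans[OF multinomial_perturbed_mixture_tests chi]) (use d0 e small that in auto)
  next
    show "gaussian_law n d f \<in> space (prob_algebra (euclidean_borel d))" for f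
      by (rule gaussian_law_in_prob_algebra)
  qed
  finally show ?thesis .
qed

theorem theorem3:
  fixes R :: real
  assumes "R > 1"
  shows "\<exists>C>0. \<exists>c>0. \<forall>n d :: nat.
    d \<ge> 2 \<longrightarrow> real d / (real n * ln (real d)) \<ge> C \<longrightarrow> real n \<ge> sqrt (real d) * ln (real d) \<longrightarrow>
      deficiency (bounded_ratio_simplex R d)
        (draws_space n d) (multinomial_law n d)
        (euclidean_borel d) (gaussian_law n d) \<ge> c"
proof -
  define \<rho> where "\<rho> = (R - 1) / (R + 1)"
  define M where "M = (48 / \<rho>\<^sup>2)\<^sup>2"
  define C where "C = 300000 + 8 * M\<^sup>2"
  \<comment> \<open>\<open>e \<le> \<rho>\<close> is the constraint that keeps the perturbations inside the ratio bound; since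
    \<open>e\<^sup>2 = 48 / sqrt n\<close>, it holds as soon as \<open>n \<ge> M\<close>.\<close>
  have \<rho>: "0 < \<rho>" "\<rho> < 1" and ratio_\<rho>: "(1 + \<rho>) / (1 - \<rho>) = R"
    using assms by (auto simp: \<rho>_def divide_simps)
  have M0: "0 \<le> M" by (simp add: M_def)
  have C0: "300000 \<le> C" "8 * M\<^sup>2 \<le> C" by (auto simp: C_def)
  have "1 / 4 \<le> deficiency (bounded_ratio_simplex R d)
      (draws_space n d) (multinomial_law n d) (euclidean_borel d) (gaussian_law n d)"
    if d: "2 \<le> d" and dC: "C \<le> real d / (real n * ln (real d))"
      and nd: "sqrt (real d) * ln (real d) \<le> real n" for n d :: nat
  proof -
    define e where "e = sqrt (48 / sqrt n)"
    have "ln 2 \<ge> (1 / 2 :: real)"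
      using ln2_ge_two_thirds by simp
    moreover have "ln (real d) \<ge> ln 2"
      using d by simp
    ultimately have ln_d: "1 / 2 \<le> ln (real d)" by linarith
    then have "0 < sqrt (real d) * ln (real d)"
      using d by (intro mult_pos_pos) auto
    then have n: "0 < n" using nd by simp
    have "C * (real n * (1 / 2)) \<le> C * (real n * ln d)"
      using C0 ln_d by (intro mult_left_mono) auto
    also have "\<dots> \<le> d"
      using dC n ln_d by (simp add: field_simps)
    finally have d_ge: "C * real n / 2 \<le> d" by simp
    have "300000 * real n / 2 \<le> C * real n / 2"
      using C0 by (intro divide_right_mono mult_right_mono) auto
    then have d_ge_n: "150000 * real n \<le> d"
      using d_ge by simp
    \<comment> \<open>A large \<open>C\<close> forces \<open>d\<close> to be large, and then the second hypothesis forces \<open>n\<close> to be large.\<close>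
    have "(2 * M)\<^sup>2 \<le> C / 2"
      using C0 by (simp add: power_mult_distrib)
    also have "\<dots> \<le> C * real n / 2"
      using n C0 by simp
    also have "\<dots> \<le> d" by (rule d_ge)
    finally have "2 * M \<le> sqrt d"
      by (rule real_le_rsqrt)
    moreover have "sqrt d * (1 / 2) \<le> sqrt d * ln d"
      using ln_d by (intro mult_left_mono) auto
    ultimately have "M \<le> n"
      using nd by simp
    then have "sqrt M \<le> sqrt n" by simp
    then have "48 / \<rho>\<^sup>2 \<le> sqrt n"
      by (simp add: M_def)
    then have "48 / sqrt n \<le> \<rho>\<^sup>2"
      using \<rho> n by (simp add: field_simps)
    then have e_le: "e \<le> \<rho>"
      using \<rho> unfolding e_def by (intro real_le_lsqrt) auto
    have e: "0 < e" "e < 1"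
      using n e_le \<rho> by (simp add: e_def, linarith)
    have "(1 + e) / (1 - e) \<le> (1 + \<rho>) / (1 - \<rho>)"
      using e e_le \<rho> by (intro frac_le) auto
    then have "(1 + e) / (1 - e) \<le> R" by (simp add: ratio_\<rho>)
    then show ?thesis
      using d n e d_ge_n by (intro deficiency_multinomial_gaussian_ge[where e = e]) (auto simp: e_def)
  qed
  moreover have "0 < C" using C0 by simp
  ultimately show ?thesis
    by (intro exI[of _ C] conjI exI[of _ "1 / 4 :: real"]) auto
qed

end
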